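(* Let $G$ be a nonsingular triangle-free graph on $6$ vertices. Then $G$ is isomorphic to one of the following eight graphs: (A) the cycle $C_6$; (B) the graph with vertices $x_1,x_2,x_3,y_1,y_2,y_3$ and edges $x_1x_2,x_2x_3,y_1y_2,y_2y_3,x_1y_1,x_2y_2,x_3y_3$ (two $4$-cycles sharing an edge, i.e. the $2\times 3$ grid $P_2\square P_3$); (C) the $4$-cycle $abcd$ (edges $ab,bc,cd,da$) together with two further vertices $e,f$ and edges $ae,bf$ (pendant vertices attached to two adjacent vertices of $C_4$); (D) the path $P_6$; (E) the tree obtained from the path $a_1a_2a_3$ by attaching one pendant vertex to each of $a_1,a_2,a_3$; (F) the $5$-cycle with one pendant vertex attached to one of its vertices; $3P_2$ (three disjoint edges); $P_2\cup P_4$ (disjoint union of an edge and a path on $4$ vertices).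
   Context: All graphs are finite and simple. A graph is nonsingular if its adjacency matrix is invertible. $P_k$ and $C_k$ denote the path and cycle on $k$ vertices; $G\cup H$ is the disjoint union and $kH$ the disjoint union of $k$ copies of $H$. *)

theory Defs
  imports
    "Graph_Theory.Digraph_Component"
    "Graph_Theory.Digraph_Isomorphism"
    "Jordan_Normal_Form.Matrix"
begin

text \<open>
  A finite simple graph is a \<open>pair_graph\<close>: a finite loop-free digraph whose arc relation
  is symmetric, so an edge \<open>uv\<close> is present as both arcs \<open>(u, v)\<close> and \<open>(v, u)\<close>.
\<close>

abbreviation graph_iso :: "'a pair_pre_digraph \<Rightarrow> 'b pair_pre_digraph \<Rightarrow> bool"
    (infix \<open>\<cong>\<^sub>G\<close> 50) where
  "G \<cong>\<^sub>G H \<equiv> digraph_iso (with_proj G) (with_proj H)"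

definition triangle_free :: "'a pair_pre_digraph \<Rightarrow> bool" where
  "triangle_free G \<longleftrightarrow>
    \<not> (\<exists>u v w. (u, v) \<in> parcs G \<and> (v, w) \<in> parcs G \<and> (w, u) \<in> parcs G)"

definition adjacency_matrix :: "'a pair_pre_digraph \<Rightarrow> 'a list \<Rightarrow> real mat" where
  "adjacency_matrix G vs =
    mat (length vs) (length vs) (\<lambda>(i, j). if (vs ! i, vs ! j) \<in> parcs G then 1 else 0)"

text \<open>
  Reordering the vertices conjugates the adjacency matrix by a permutation matrix, so its
  invertibility does not depend on the enumeration \<open>vs\<close>.
\<close>

definition nonsingular_graph :: "'a pair_pre_digraph \<Rightarrow> bool" where
  "nonsingular_graph G \<longleftrightarrow>
    (\<exists>vs. distinct vs \<and> set vs = pverts G \<and> invertible_mat (adjacency_matrix G vs))"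

text \<open>Each edge is listed in \<open>E\<close> in one orientation only.\<close>

definition graph_of_edges :: "'a set \<Rightarrow> ('a \<times> 'a) set \<Rightarrow> 'a pair_pre_digraph" where
  "graph_of_edges V E = \<lparr> pverts = V, parcs = E \<union> E\<inverse> \<rparr>"

definition path_graph :: "nat \<Rightarrow> nat pair_pre_digraph" where
  "path_graph k = graph_of_edges {..<k} {(i, Suc i) | i. Suc i < k}"

text \<open>A simple graph, and a cycle, only for \<open>k \<ge> 3\<close>.\<close>

definition cycle_graph :: "nat \<Rightarrow> nat pair_pre_digraph" where
  "cycle_graph k = graph_of_edges {..<k} {(i, Suc i mod k) | i. i < k}"

definition disjoint_union ::
    "'a pair_pre_digraph \<Rightarrow> 'b pair_pre_digraph \<Rightarrow> ('a + 'b) pair_pre_digraph" where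
  "disjoint_union G H =
    \<lparr> pverts = Inl ` pverts G \<union> Inr ` pverts H,
      parcs = map_prod Inl Inl ` parcs G \<union> map_prod Inr Inr ` parcs H \<rparr>"

definition copies :: "nat \<Rightarrow> 'a pair_pre_digraph \<Rightarrow> (nat \<times> 'a) pair_pre_digraph" where
  "copies k G =
    \<lparr> pverts = {..<k} \<times> pverts G,
      parcs = {((i, u), (i, v)) | i u v. i < k \<and> (u, v) \<in> parcs G} \<rparr>"

text \<open>\<open>w\<close> is meant to be a fresh vertex, and \<open>v\<close> a vertex of the graph.\<close>

definition attach_pendant ::
    "'a \<Rightarrow> 'a \<Rightarrow> 'a pair_pre_digraph \<Rightarrow> 'a pair_pre_digraph" where
  "attach_pendant v w G =
    \<lparr> pverts = insert w (pverts G), parcs = parcs G \<union> {(v, w), (w, v)} \<rparr>"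

text \<open>Vertices: \<open>x\<^sub>i\<close> is \<open>i\<close> and \<open>y\<^sub>i\<close> is \<open>i + 3\<close>.\<close>

definition graph_B :: "nat pair_pre_digraph" where
  "graph_B = graph_of_edges {1, 2, 3, 4, 5, 6}
    {(1, 2), (2, 3), (4, 5), (5, 6), (1, 4), (2, 5), (3, 6)}"

text \<open>Vertices: \<open>a, b, c, d, e, f\<close> are \<open>1, 2, 3, 4, 5, 6\<close>.\<close>

definition graph_C :: "nat pair_pre_digraph" where
  "graph_C = graph_of_edges {1, 2, 3, 4, 5, 6}
    {(1, 2), (2, 3), (3, 4), (4, 1), (1, 5), (2, 6)}"

definition graph_E :: "nat pair_pre_digraph" where
  "graph_E = attach_pendant 0 3 (attach_pendant 1 4 (attach_pendant 2 5 (path_graph 3)))"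

definition graph_F :: "nat pair_pre_digraph" where
  "graph_F = attach_pendant 0 5 (cycle_graph 5)"

end

(*
  A nonzero determinant has a nonzero term, so some permutation moves every vertex along an edge.
  It has no fixed points and no 3-cycles, so on six vertices it is of cycle type 2+2+2, 4+2 or 6,
  and G has a perfect matching {a_i, b_i}, i = 1, 2, 3. Moreover G has no twins (vertices with the
  same neighbourhood), as they give equal rows. Being triangle-free, G joins two matching edges
  {a_i, b_i} and {a_j, b_j} either only by parallel edges (a_i a_j, b_i b_j) or only by crossing
  ones (a_i b_j, b_i a_j), and interchanging a_i with b_i swaps the two kinds for both pairs
  containing i. So one may assume that there are no parallel edges, or that all three pairs have a
  parallel edge. In the first case G is bipartite and described by the digraph on {1, 2, 3} with an
  arc from i to j whenever a_i is adjacent to b_j; the digraphs without twins yield every graph of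
  the list but F. In the second case G contains a 5-cycle, and twin-freeness leaves only F.
*)

theory Submission
  imports Defs "Jordan_Normal_Form.Determinant"
begin

section \<open>Isomorphisms from vertex bijections\<close>

text \<open>An arc of a pair digraph is the pair of its ends, so \<open>f\<close> already determines
  the arc map \<open>map_prod f f\<close> that \<open>digraph_iso\<close> asks for.\<close>

lemma graph_iso_bij_betw:
  assumes "pair_wf_digraph G"
    and f: "bij_betw f (pverts G) (pverts H)"
    and H: "pair_wf_digraph H"
    and arcs: "\<And>u v. u \<in> pverts G \<Longrightarrow> v \<in> pverts G \<Longrightarrow> (u, v) \<in> parcs G \<longleftrightarrow> (f u, f v) \<in> parcs H"
  shows "G \<cong>\<^sub>G H"
proof -
  interpret pair_wf_digraph G by fact
  define h where "h = \<lparr>iso_verts = f, iso_arcs = map_prod f f, iso_head = snd, iso_tail = fst\<rparr>"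
  have GV: "parcs G \<subseteq> pverts G \<times> pverts G"
    using in_arcsD1 in_arcsD2 by auto
  have inj: "inj_on f (pverts G)" and im: "f ` pverts G = pverts H"
    using f by (auto simp: bij_betw_def)
  have "inj_on (map_prod f f) (parcs G)"
    using map_prod_inj_on[OF inj inj] GV by (rule inj_on_subset)
  moreover have "wf_digraph (with_proj G)" by unfold_locales
  ultimately have "pre_digraph.digraph_isomorphism (with_proj G) h"
    using inj unfolding pre_digraph.digraph_isomorphism_def h_def by simp
  moreover have "map_prod f f ` parcs G = parcs H"
  proof
    show "map_prod f f ` parcs G \<subseteq> parcs H"
      using GV arcs by auto
    show "parcs H \<subseteq> map_prod f f ` parcs G"
    proof (clarify)
      fix x y assume xy: "(x, y) \<in> parcs H"
      then obtain u v where "u \<in> pverts G" "v \<in> pverts G" "x = f u" "y = f v"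
        using pair_wf_digraph.wellformed'[OF H] im by (metis imageE)
      then show "(x, y) \<in> map_prod f f ` parcs G"
        using xy arcs by force
    qed
  qed
  then have "with_proj H = app_iso h (with_proj G)"
    using im by (simp add: h_def app_iso_def with_proj_def)
  ultimately show ?thesis
    unfolding digraph_iso_def by blast
qed

text \<open>Meant for concrete lists, where the arc condition unfolds to finitely many adjacency
  checks.\<close>

lemma graph_iso_lists:
  assumes G: "pair_wf_digraph G"
    and vs: "distinct vs" "set vs = pverts G"
    and ws: "distinct ws" "set ws = pverts H"
    and len: "length vs = length ws"
    and H: "pair_wf_digraph H"
    and arcs: "\<forall>(u, x) \<in> set (zip vs ws). \<forall>(v, y) \<in> set (zip vs ws).
      (u, v) \<in> parcs G \<longleftrightarrow> (x, y) \<in> parcs H"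
  shows "G \<cong>\<^sub>G H"
proof (rule graph_iso_bij_betw[OF G _ H])
  define n where "n = length vs"
  define k where "k = the_inv_into {..<n} ((!) vs)"
  have bv: "bij_betw ((!) vs) {..<n} (pverts G)" and bw: "bij_betw ((!) ws) {..<n} (pverts H)"
    using vs ws len by (auto simp: n_def intro: bij_betw_nth)
  have bk: "bij_betw k (pverts G) {..<n}"
    unfolding k_def using bv by (rule bij_betw_the_inv_into)
  show "bij_betw ((!) ws \<circ> k) (pverts G) (pverts H)"
    using bk bw by (rule bij_betw_trans)
  fix u v assume "u \<in> pverts G" "v \<in> pverts G"
  moreover have "(w, (ws ! k w)) \<in> set (zip vs ws)" if "w \<in> pverts G" for w
  proof -
    have "k w < n" "vs ! k w = w"
      using that bk bv f_the_inv_into_f_bij_betw[OF bv] unfolding k_def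
      by (auto dest: bij_betwE)
    then show ?thesis
      using len by (force simp: in_set_zip n_def)
  qed
  ultimately show "(u, v) \<in> parcs G \<longleftrightarrow> (((!) ws \<circ> k) u, ((!) ws \<circ> k) v) \<in> parcs H"
    using arcs by fastforce
qed

section \<open>Explicit descriptions of the target graphs\<close>

lemma path_graph_simps [simp]:
  "pverts (path_graph k) = {..<k}"
  "(i, j) \<in> parcs (path_graph k) \<longleftrightarrow> i < k \<and> j < k \<and> (j = Suc i \<or> i = Suc j)"
  by (auto simp: path_graph_def graph_of_edges_def)

lemma cycle_graph_simps [simp]:
  "pverts (cycle_graph k) = {..<k}"
  "(i, j) \<in> parcs (cycle_graph k) \<longleftrightarrow> i < k \<and> j < k \<and> (j = Suc i mod k \<or> i = Suc j mod k)"
  by (auto simp: cycle_graph_def graph_of_edges_def) 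

lemma graph_of_edges_simps [simp]:
  "pverts (graph_of_edges V E) = V"
  "(u, v) \<in> parcs (graph_of_edges V E) \<longleftrightarrow> (u, v) \<in> E \<or> (v, u) \<in> E"
  by (simp_all add: graph_of_edges_def)

lemma attach_pendant_simps [simp]:
  "pverts (attach_pendant v w G) = insert w (pverts G)"
  "(x, y) \<in> parcs (attach_pendant v w G) \<longleftrightarrow> (x, y) \<in> parcs G \<or> x = v \<and> y = w \<or> x = w \<and> y = v"
  by (auto simp: attach_pendant_def)

lemma disjoint_union_simps [simp]:
  "pverts (disjoint_union G H) = Inl ` pverts G \<union> Inr ` pverts H"
  "(Inl u, Inl v) \<in> parcs (disjoint_union G H) \<longleftrightarrow> (u, v) \<in> parcs G"
  "(Inr x, Inr y) \<in> parcs (disjoint_union G H) \<longleftrightarrow> (x, y) \<in> parcs H"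
  "(Inl u, Inr y) \<notin> parcs (disjoint_union G H)"
  "(Inr x, Inl v) \<notin> parcs (disjoint_union G H)"
  by (auto simp: disjoint_union_def)

lemma copies_simps [simp]:
  "pverts (copies k G) = {..<k} \<times> pverts G"
  "((i, u), (j, v)) \<in> parcs (copies k G) \<longleftrightarrow> i = j \<and> i < k \<and> (u, v) \<in> parcs G"
  by (auto simp: copies_def)

lemma pair_wf_digraph_iff:
  "pair_wf_digraph G \<longleftrightarrow> (\<forall>u v. (u, v) \<in> parcs G \<longrightarrow> u \<in> pverts G \<and> v \<in> pverts G)"
  unfolding pair_wf_digraph_def by fastforce

lemma pair_wf_digraph_path_graph: "pair_wf_digraph (path_graph k)"
  and pair_wf_digraph_cycle_graph: "pair_wf_digraph (cycle_graph k)"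
  by (simp_all add: pair_wf_digraph_iff)

lemma pair_wf_digraph_graph_of_edges:
  "E \<subseteq> V \<times> V \<Longrightarrow> pair_wf_digraph (graph_of_edges V E)"
  by (auto simp: pair_wf_digraph_iff)

lemma pair_wf_digraph_attach_pendant:
  "pair_wf_digraph G \<Longrightarrow> v \<in> pverts G \<Longrightarrow> pair_wf_digraph (attach_pendant v w G)"
  by (auto simp: pair_wf_digraph_iff)

lemma pair_wf_digraph_disjoint_union:
  "pair_wf_digraph G \<Longrightarrow> pair_wf_digraph H \<Longrightarrow> pair_wf_digraph (disjoint_union G H)"
  by (auto simp: pair_wf_digraph_iff disjoint_union_def)

lemma pair_wf_digraph_copies: "pair_wf_digraph G \<Longrightarrow> pair_wf_digraph (copies k G)"
  by (auto simp: pair_wf_digraph_iff)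

lemmas pair_wf_digraph_intros =
  pair_wf_digraph_path_graph pair_wf_digraph_cycle_graph pair_wf_digraph_graph_of_edges
  pair_wf_digraph_attach_pendant pair_wf_digraph_disjoint_union pair_wf_digraph_copies

lemma pair_wf_digraph_graph_B: "pair_wf_digraph graph_B"
  and pair_wf_digraph_graph_C: "pair_wf_digraph graph_C"
  and pair_wf_digraph_graph_E: "pair_wf_digraph graph_E"
  and pair_wf_digraph_graph_F: "pair_wf_digraph graph_F"
  unfolding graph_B_def graph_C_def graph_E_def graph_F_def
  by (intro pair_wf_digraph_intros; simp)+

lemma pverts_targets:
  "pverts graph_B = {1, 2, 3, 4, 5, 6}" "pverts graph_C = {1, 2, 3, 4, 5, 6}"
  "pverts graph_E = {0, 1, 2, 3, 4, 5}" "pverts graph_F = {0, 1, 2, 3, 4, 5}"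
  "{..<6::nat} = {0, 1, 2, 3, 4, 5}"
  "{..<3::nat} \<times> {..<2::nat} = {(0, 0), (0, 1), (1, 0), (1, 1), (2, 0), (2, 1)}"
  "Inl ` {..<2::nat} \<union> Inr ` {..<4::nat} = {Inl 0, Inl 1, Inr 0, Inr 1, Inr 2, Inr 3}"
  by (auto simp: graph_B_def graph_C_def graph_E_def graph_F_def lessThan_nat_numeral lessThan_Suc)

text \<open>Unfolding only below \<open>parcs\<close> leaves terms such as
  \<open>pverts graph_B\<close> to \<open>pverts_targets\<close>, and well-formedness to its own
  lemmas.\<close>

lemmas parcs_targets =
  graph_B_def[THEN arg_cong[where f = parcs]] graph_C_def[THEN arg_cong[where f = parcs]]
  graph_E_def[THEN arg_cong[where f = parcs]] graph_F_def[THEN arg_cong[where f = parcs]]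

lemmas targets = pverts_targets parcs_targets pair_wf_digraph_intros pair_wf_digraph_graph_B
  pair_wf_digraph_graph_C pair_wf_digraph_graph_E pair_wf_digraph_graph_F

definition listed :: "'a pair_pre_digraph \<Rightarrow> bool" where
  "listed G \<longleftrightarrow>
    G \<cong>\<^sub>G cycle_graph 6 \<or>
    G \<cong>\<^sub>G graph_B \<or>
    G \<cong>\<^sub>G graph_C \<or>
    G \<cong>\<^sub>G path_graph 6 \<or>
    G \<cong>\<^sub>G graph_E \<or>
    G \<cong>\<^sub>G graph_F \<or>
    G \<cong>\<^sub>G copies 3 (path_graph 2) \<or>
    G \<cong>\<^sub>G disjoint_union (path_graph 2) (path_graph 4)"

section \<open>Perfect matchings from permutations of six points\<close>

text \<open>The proof follows the orbits of \<open>f\<close> and pairs every second vertex with its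
  image, which gives a matching because all cycles are even. Injectivity keeps each new image away
  from the images already met.\<close>

lemma six_permutation_matching:
  fixes E :: "'a \<Rightarrow> 'a \<Rightarrow> bool"
  assumes card: "card V = 6"
    and f: "bij_betw f V V"
    and edge: "\<And>v. v \<in> V \<Longrightarrow> E v (f v)"
    and irrefl: "\<And>v. \<not> E v v"
    and tri: "\<And>u v w. \<not> (E u v \<and> E v w \<and> E w u)"
  shows "\<exists>a b c d e g. distinct [a, b, c, d, e, g] \<and> set [a, b, c, d, e, g] = V \<and>
    E a b \<and> E c d \<and> E e g"
proof -
  have fin: "finite V" using card by (auto intro: card_ge_0_finite)
  have fV: "f v \<in> V" if "v \<in> V" for v using f that by (auto dest: bij_betwE)
  have inj: "f u = f v \<longleftrightarrow> u = v" if "u \<in> V" "v \<in> V" for u v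
    using f that by (auto simp: bij_betw_def inj_on_eq_iff)
  have nfix: "f v \<noteq> v" if "v \<in> V" for v using edge[OF that] irrefl by metis
  have n3: "f (f (f v)) \<noteq> v" if "v \<in> V" for v
    using edge[OF that] edge[OF fV[OF that]] edge[OF fV[OF fV[OF that]]] tri by metis
  have ex: "\<exists>v\<in>V. v \<notin> set xs" if "length xs < 6" for xs
  proof (rule ccontr)
    assume "\<not> ?thesis"
    then have "V \<subseteq> set xs" by auto
    then have "card V \<le> card (set xs)" by (simp add: card_mono)
    then show False using card card_length[of xs] that by simp
  qed
  have full: "set xs = V" if "distinct xs" "length xs = 6" "set xs \<subseteq> V" for xs
    using that card fin by (metis card_subset_eq distinct_card)
  have matching: ?thesis
    if "distinct [a, b, c, d, e, g]" "set [a, b, c, d, e, g] \<subseteq> V" "E a b" "E c d" "E e g"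
    for a b c d e g
    using full[OF that(1) _ that(2)] that by (intro exI conjI) (assumption | simp)+
  obtain a where a: "a \<in> V" using ex[of "[]"] by auto
  obtain b where b_eq: "f a = b" by simp
  have b: "b \<in> V" "b \<noteq> a" "E a b" using fV[OF a] nfix[OF a] edge[OF a] b_eq by auto
  show ?thesis
  proof (cases "f b = a")
    case True
    obtain c where c: "c \<in> V" "c \<noteq> a" "c \<noteq> b" using ex[of "[a,b]"] by auto
    obtain d where d_eq: "f c = d" by simp
    have d: "d \<in> V" "d \<noteq> c" "E c d" "d \<noteq> a" "d \<noteq> b"
      using a b c fV[OF c(1)] nfix[OF c(1)] edge[OF c(1)] inj[of c a] inj[of c b] True
        b_eq d_eq by auto
    show ?thesis
    proof (cases "f d = c")
      case fd: True
      obtain e where e: "e \<in> V" "e \<noteq> a" "e \<noteq> b" "e \<noteq> c" "e \<noteq> d" using ex[of "[a,b,c,d]"] by auto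
      obtain g where g_eq: "f e = g" by simp
      have g: "g \<in> V" "g \<noteq> e" "E e g" "g \<noteq> a" "g \<noteq> b" "g \<noteq> c" "g \<noteq> d"
        using a b c d e fV[OF e(1)] nfix[OF e(1)] edge[OF e(1)] inj[of e a] inj[of e b] inj[of e c] inj[of e d] True fd
          b_eq d_eq g_eq by auto
      show ?thesis
        using a b c d e g by (intro matching[of a b c d e g]) auto
    next
      \<comment> \<open>The orbit of \<open>c\<close> goes on to \<open>e\<close> and
        \<open>g\<close>. By \<open>n3\<close> it does not close after three steps, so
        \<open>g\<close> is not \<open>c\<close>.\<close>
      case False
      obtain e where e_eq: "f d = e" by simp
      have e: "e \<in> V" "e \<noteq> a" "e \<noteq> b" "e \<noteq> c" "e \<noteq> d"
        using a b c d fV[OF d(1)] nfix[OF d(1)] edge[OF d(1)] inj[of d a] inj[of d b] inj[of d c] True False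
          b_eq d_eq e_eq by auto
      obtain g where g_eq: "f e = g" by simp
      have g: "g \<in> V" "g \<noteq> e" "E e g" "g \<noteq> a" "g \<noteq> b" "g \<noteq> c" "g \<noteq> d"
        using a b c d e fV[OF e(1)] nfix[OF e(1)] edge[OF e(1)] inj[of e a] inj[of e b] inj[of e c] inj[of e d] True False n3[OF c(1)]
          b_eq d_eq e_eq g_eq by auto
      show ?thesis
        using a b c d e g by (intro matching[of a b c d e g]) auto
    qed
  next
    case False
    obtain c where c_eq: "f b = c" by simp
    have c: "c \<in> V" "c \<noteq> a" "c \<noteq> b"
      using a b fV[OF b(1)] nfix[OF b(1)] edge[OF b(1)] inj[of b a] False
        b_eq c_eq by auto
    obtain d where d_eq: "f c = d" by simp
    have d: "d \<in> V" "d \<noteq> c" "E c d" "d \<noteq> a" "d \<noteq> b"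
      using a b c fV[OF c(1)] nfix[OF c(1)] edge[OF c(1)] inj[of c a] inj[of c b] n3[OF a]
        b_eq c_eq d_eq by auto
    show ?thesis
    proof (cases "f d = a")
      \<comment> \<open>Here \<open>a\<close>, \<open>b\<close>, \<open>c\<close>, \<open>d\<close>
        form a 4-cycle, and the two remaining vertices are \<open>e\<close> and its image.\<close>
      case fd: True
      obtain e where e: "e \<in> V" "e \<noteq> a" "e \<noteq> b" "e \<noteq> c" "e \<noteq> d" using ex[of "[a,b,c,d]"] by auto
      obtain g where g_eq: "f e = g" by simp
      have g: "g \<in> V" "g \<noteq> e" "E e g" "g \<noteq> a" "g \<noteq> b" "g \<noteq> c" "g \<noteq> d"
        using a b c d e fV[OF e(1)] nfix[OF e(1)] edge[OF e(1)] inj[of e a] inj[of e b] inj[of e c] inj[of e d] fd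
          b_eq c_eq d_eq g_eq by auto
      show ?thesis
        using a b c d e g by (intro matching[of a b c d e g]) auto
    next
      case fd: False
      obtain e where e_eq: "f d = e" by simp
      have e: "e \<in> V" "e \<noteq> a" "e \<noteq> b" "e \<noteq> c" "e \<noteq> d"
        using a b c d fV[OF d(1)] nfix[OF d(1)] edge[OF d(1)] inj[of d a] inj[of d b] inj[of d c] fd
          b_eq c_eq d_eq e_eq by auto
      obtain g where g_eq: "f e = g" by simp
      \<comment> \<open>Otherwise \<open>a\<close>, \<open>b\<close>, \<open>c\<close>,
        \<open>d\<close>, \<open>e\<close> would form a 5-cycle and the sixth vertex
        \<open>h\<close> would be a fixed point.\<close>
      have "g \<noteq> a"
      proof
        assume ga: "g = a"
        obtain h where h: "h \<in> V" "h \<notin> {a, b, c, d, e}" using ex[of "[a,b,c,d,e]"] by auto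
        have "f h \<notin> {a, b, c, d, e}"
          using h a b c d e ga inj[of h a] inj[of h b] inj[of h c] inj[of h d] inj[of h e]
            b_eq c_eq d_eq e_eq g_eq by auto
        moreover have "set [a, b, c, d, e, h] = V"
          using a b c d e h by (intro full) auto
        ultimately have "f h = h"
          using fV[OF h(1)] by (metis empty_iff insert_iff list.set)
        then show False using h nfix by blast
      qed
      have g: "g \<in> V" "g \<noteq> e" "E e g" "g \<noteq> b" "g \<noteq> c" "g \<noteq> d"
        using a b c d e fV[OF e(1)] nfix[OF e(1)] edge[OF e(1)] inj[of e a] inj[of e b] inj[of e c] inj[of e d]
          b_eq c_eq d_eq e_eq g_eq by auto
      show ?thesis
        using a b c d e g \<open>g \<noteq> a\<close> by (intro matching[of a b c d e g]) auto
    qed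
  qed
qed

section \<open>Consequences of nonsingularity\<close>

lemma invertible_mat_det_nonzero:
  fixes A :: "'a :: idom mat"
  assumes "A \<in> carrier_mat n n" "invertible_mat A"
  shows "det A \<noteq> 0"
proof -
  obtain B where AB: "A * B = 1\<^sub>m n" and BA: "B * A = 1\<^sub>m (dim_row B)"
    using assms unfolding invertible_mat_def inverts_mat_def by auto
  \<comment> \<open>\<open>invertible_mat\<close> does not state the shape of \<open>B\<close>; it
    is read off the two products with \<open>A\<close>.\<close>
  have "dim_row B = n" "dim_col B = n"
    using arg_cong[OF BA, of dim_col] arg_cong[OF AB, of dim_col] assms(1) by auto
  then have "B \<in> carrier_mat n n" by auto
  then have "det A * det B = 1"
    using det_mult[OF assms(1), of B] AB by simp
  then show ?thesis by auto
qed

text \<open>A nonzero term of the Leibniz formula comes from a permutation \<open>p\<close> of the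
  indices that meets no zero entry; the enumeration \<open>vs\<close> carries \<open>p\<close> over
  to the vertices.\<close>

lemma nonsingular_graph_permutation:
  assumes "nonsingular_graph G"
  shows "\<exists>f. bij_betw f (pverts G) (pverts G) \<and> (\<forall>v\<in>pverts G. (v, f v) \<in> parcs G)"
proof -
  obtain vs where vs: "distinct vs" "set vs = pverts G"
    and inv: "invertible_mat (adjacency_matrix G vs)"
    using assms unfolding nonsingular_graph_def by blast
  define n where "n = length vs"
  have A: "adjacency_matrix G vs \<in> carrier_mat n n"
    by (simp add: adjacency_matrix_def n_def)
  have "det (adjacency_matrix G vs) \<noteq> 0"
    using A inv by (rule invertible_mat_det_nonzero)
  then obtain p where p: "p permutes {0..<n}"
    and "signof p * (\<Prod>i = 0..<n. adjacency_matrix G vs $$ (i, p i)) \<noteq> 0"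
    unfolding det_def'[OF A] by (metis (mono_tags, lifting) mem_Collect_eq sum.neutral)
  then have nz: "adjacency_matrix G vs $$ (i, p i) \<noteq> 0" if "i < n" for i
    using that by (auto simp: prod_zero_iff)
  have edge: "(vs ! i, vs ! p i) \<in> parcs G" if "i < n" for i
    using nz[OF that] that permutes_in_image[OF p, of i]
    by (auto simp: adjacency_matrix_def n_def split: if_splits)
  have bv: "bij_betw ((!) vs) {0..<n} (pverts G)"
    using vs by (auto simp: n_def intro: bij_betw_nth)
  define k where "k = the_inv_into {0..<n} ((!) vs)"
  have bk: "bij_betw k (pverts G) {0..<n}"
    unfolding k_def using bv by (rule bij_betw_the_inv_into)
  have "bij_betw ((!) vs \<circ> p \<circ> k) (pverts G) (pverts G)"
    using bk permutes_imp_bij[OF p] bv by (auto intro: bij_betw_trans)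
  moreover have "(v, ((!) vs \<circ> p \<circ> k) v) \<in> parcs G" if "v \<in> pverts G" for v
  proof -
    have "k v < n" "vs ! k v = v"
      using that bk f_the_inv_into_f_bij_betw[OF bv] unfolding k_def
      by (auto dest: bij_betwE)
    then show ?thesis using edge[of "k v"] by simp
  qed
  ultimately show ?thesis by blast
qed

text \<open>Two vertices with the same neighbours give two equal rows, hence determinant
  zero.\<close>

lemma nonsingular_graph_twin_free:
  assumes "nonsingular_graph G" "u \<in> pverts G" "v \<in> pverts G" "u \<noteq> v"
  shows "\<exists>w\<in>pverts G. ((u, w) \<in> parcs G) \<noteq> ((v, w) \<in> parcs G)"
proof (rule ccontr)
  assume twin: "\<not> ?thesis"
  obtain vs where vs: "distinct vs" "set vs = pverts G"
    and inv: "invertible_mat (adjacency_matrix G vs)"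
    using assms unfolding nonsingular_graph_def by blast
  define n where "n = length vs"
  have A: "adjacency_matrix G vs \<in> carrier_mat n n"
    by (simp add: adjacency_matrix_def n_def)
  obtain i j where ij: "i < n" "j < n" "vs ! i = u" "vs ! j = v"
    using assms vs by (metis in_set_conv_nth n_def)
  have "row (adjacency_matrix G vs) i = row (adjacency_matrix G vs) j"
    using ij twin vs by (intro eq_vecI) (auto simp: adjacency_matrix_def n_def)
  then have "det (adjacency_matrix G vs) = 0"
    using det_identical_rows[OF A] ij assms by metis
  then show False
    using invertible_mat_det_nonzero[OF A inv] by simp
qed

section \<open>Digraphs on three vertices without twins\<close>

text \<open>
  The digraphs on three vertices, up to isomorphism, that meet the twin condition; \<open>dij\<close> says that
  there is an arc from \<open>i\<close> to \<open>j\<close>.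
\<close>

inductive normal :: "bool \<Rightarrow> bool \<Rightarrow> bool \<Rightarrow> bool \<Rightarrow> bool \<Rightarrow> bool \<Rightarrow> bool" where
  none: "normal False False False False False False"
| arc: "normal True False False False False False"
| path: "normal True False False False True False"
| out: "normal True False True False False False"
| inn: "normal False True False True False False"
| cycle: "normal True False False True True False"
| trans: "normal True False True False True False"
| B1: "normal True True True True False False"
| B2: "normal True True True False False True"

text \<open>
  In the premises, \<open>i\<close> and \<open>j\<close> are joined in both directions; the conclusion then says that
  neither \<open>x\<^sub>i, x\<^sub>j\<close> nor \<open>y\<^sub>i, y\<^sub>j\<close> are twins in the bipartite graph of the digraph.
\<close>

lemma digraph_three_normal:
  assumes "d12 \<and> d21 \<Longrightarrow> d13 \<noteq> d23 \<and> d31 \<noteq> d32"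
    and "d13 \<and> d31 \<Longrightarrow> d12 \<noteq> d32 \<and> d21 \<noteq> d23"
    and "d23 \<and> d32 \<Longrightarrow> d21 \<noteq> d31 \<and> d12 \<noteq> d13"
  shows "normal d12 d21 d13 d31 d23 d32 \<or> normal d13 d31 d12 d21 d32 d23 \<or>
    normal d21 d12 d23 d32 d13 d31 \<or> normal d23 d32 d21 d12 d31 d13 \<or>
    normal d31 d13 d32 d23 d12 d21 \<or> normal d32 d23 d31 d13 d21 d12"
  \<comment> \<open>The six disjuncts are the relabellings of the three vertices; all 64 digraphs
    are checked.\<close>
  using assms unfolding normal.simps
  by (cases d12; cases d21; cases d13; cases d31; cases d23; cases d32) simp_all

section \<open>Twin-free triangle-free graphs with a perfect matching\<close>

text \<open>Nonsingularity enters the case analysis through two consequences: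
  \<open>twin_free\<close>, assumed here, and a perfect matching, supplied by
  \<open>matched\<close>.\<close>

locale twin_free_six_graph = pair_graph G for G :: "'a pair_pre_digraph" +
  assumes card6: "card (pverts G) = 6"
    and tri: "triangle_free G"
    and twin_free: "\<lbrakk>u \<in> pverts G; v \<in> pverts G; u \<noteq> v\<rbrakk> \<Longrightarrow>
      \<exists>w\<in>pverts G. ((u, w) \<in> parcs G) \<noteq> ((v, w) \<in> parcs G)"
begin

abbreviation adj :: "'a \<Rightarrow> 'a \<Rightarrow> bool" where
  "adj u v \<equiv> (u, v) \<in> parcs G"

lemma adj_commute: "adj u v \<longleftrightarrow> adj v u"
  using arcs_symmetric by blast

lemma adj_irrefl [simp]: "\<not> adj u u"
  using pair_no_loops by force

lemma no_triangle: "\<lbrakk>adj u v; adj v w\<rbrakk> \<Longrightarrow> \<not> adj u w"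
  using tri adj_commute unfolding triangle_free_def by blast

lemma graph_iso_lists':
  assumes "distinct vs" "set vs = pverts G" "distinct ws" "set ws = pverts H"
    "length vs = length ws" "pair_wf_digraph H"
    "\<forall>(u, x) \<in> set (zip vs ws). \<forall>(v, y) \<in> set (zip vs ws). adj u v \<longleftrightarrow> (x, y) \<in> parcs H"
  shows "G \<cong>\<^sub>G H"
  by (rule graph_iso_lists) (use assms pair_wf_digraph in auto)

text \<open>Distinctness follows from \<open>card6\<close>, as six names exhaust a set of six
  vertices.\<close>

definition matched :: "'a \<Rightarrow> 'a \<Rightarrow> 'a \<Rightarrow> 'a \<Rightarrow> 'a \<Rightarrow> 'a \<Rightarrow> bool" where
  "matched a1 b1 a2 b2 a3 b3 \<longleftrightarrow>
    pverts G = {a1, b1, a2, b2, a3, b3} \<and> adj a1 b1 \<and> adj a2 b2 \<and> adj a3 b3"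

definition bipartitioned :: "'a \<Rightarrow> 'a \<Rightarrow> 'a \<Rightarrow> 'a \<Rightarrow> 'a \<Rightarrow> 'a \<Rightarrow> bool" where
  "bipartitioned x1 y1 x2 y2 x3 y3 \<longleftrightarrow> matched x1 y1 x2 y2 x3 y3 \<and>
    \<not> adj x1 x2 \<and> \<not> adj x1 x3 \<and> \<not> adj x2 x3 \<and> \<not> adj y1 y2 \<and> \<not> adj y1 y3 \<and> \<not> adj y2 y3"

lemma matchedD:
  assumes "matched a1 b1 a2 b2 a3 b3"
  shows "distinct [a1, b1, a2, b2, a3, b3]" "pverts G = {a1, b1, a2, b2, a3, b3}"
    "adj a1 b1" "adj a2 b2" "adj a3 b3" "adj b1 a1" "adj b2 a2" "adj b3 a3"
proof -
  show V: "pverts G = {a1, b1, a2, b2, a3, b3}"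
    and "adj a1 b1" "adj a2 b2" "adj a3 b3" "adj b1 a1" "adj b2 a2" "adj b3 a3"
    using assms arcs_symmetric by (simp_all add: matched_def)
  show "distinct [a1, b1, a2, b2, a3, b3]"
    using card6 by (intro card_distinct) (simp add: V)
qed

section \<open>The bipartite case\<close>

lemma bipartitioned_nonadj:
  assumes "bipartitioned x1 y1 x2 y2 x3 y3"
  shows "\<not> adj x1 x2" "\<not> adj x1 x3" "\<not> adj x2 x3" "\<not> adj y1 y2" "\<not> adj y1 y3" "\<not> adj y2 y3"
    "\<not> adj x2 x1" "\<not> adj x3 x1" "\<not> adj x3 x2" "\<not> adj y2 y1" "\<not> adj y3 y1" "\<not> adj y3 y2"
  using assms by (auto simp: bipartitioned_def dest: arcs_symmetric)

lemma bipartitioned_matched: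
  "bipartitioned x1 y1 x2 y2 x3 y3 \<Longrightarrow> matched x1 y1 x2 y2 x3 y3"
  by (simp add: bipartitioned_def)

text \<open>In each case the vertices are listed in the order in which the target numbers its
  own.\<close>

lemma bipartitioned_normal_listed:
  assumes bip: "bipartitioned x1 y1 x2 y2 x3 y3"
    and normal: "normal (adj x1 y2) (adj x2 y1) (adj x1 y3) (adj x3 y1) (adj x2 y3) (adj x3 y2)"
  shows "listed G"
proof -
  note m = matchedD[OF bipartitioned_matched[OF bip]] and na = bipartitioned_nonadj[OF bip]
  have V: "pverts G = {x1, y1, x2, y2, x3, y3}" by (fact m(2))
  note sym = adj_commute[of y1 x2] adj_commute[of y1 x3] adj_commute[of y2 x1]
    adj_commute[of y2 x3] adj_commute[of y3 x1] adj_commute[of y3 x2]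
  note ne = m(1)[simplified] distinct_rev[THEN iffD2, OF m(1), simplified]
  from normal show ?thesis
  proof cases
    case none
    have "G \<cong>\<^sub>G copies 3 (path_graph 2)"
      by (intro graph_iso_lists'[of "[x1, y1, x2, y2, x3, y3]"
        "[(0, 0), (0, 1), (1, 0), (1, 1), (2, 0), (2, 1)]"]) (simp_all add: ne targets V insert_commute m(3-8) na sym none)
    then show ?thesis by (simp add: listed_def)
  next
    case arc
    have "G \<cong>\<^sub>G disjoint_union (path_graph 2) (path_graph 4)"
      by (intro graph_iso_lists'[of "[x3, y3, y1, x1, y2, x2]"
        "[Inl 0, Inl 1, Inr 0, Inr 1, Inr 2, Inr 3]"]) (simp_all add: ne targets V insert_commute m(3-8) na sym arc)
    then show ?thesis by (simp add: listed_def)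
  next
    case path
    have "G \<cong>\<^sub>G path_graph 6"
      by (intro graph_iso_lists'[of "[y1, x1, y2, x2, y3, x3]" "[0, 1, 2, 3, 4, 5]"])
        (simp_all add: ne targets V insert_commute m(3-8) na sym path)
    then show ?thesis by (simp add: listed_def)
  next
    \<comment> \<open>\<open>x1\<close> is adjacent to \<open>y1\<close>, \<open>y2\<close> and
      \<open>y3\<close>, so the spine of the tree is \<open>y2\<close>, \<open>x1\<close>,
      \<open>y3\<close>, with pendants \<open>x2\<close>, \<open>y1\<close>,
      \<open>x3\<close>.\<close>
    case out
    have "G \<cong>\<^sub>G graph_E"
      by (intro graph_iso_lists'[of "[y2, x1, y3, x2, y1, x3]" "[0, 1, 2, 3, 4, 5]"])
        (simp_all add: ne targets V insert_commute m(3-8) na sym out)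
    then show ?thesis by (simp add: listed_def)
  next
    \<comment> \<open>The reverse of the digraph in \<open>out\<close>: the two sides exchange their
      roles.\<close>
    case inn
    have "G \<cong>\<^sub>G graph_E"
      by (intro graph_iso_lists'[of "[x2, y1, x3, y2, x1, y3]" "[0, 1, 2, 3, 4, 5]"])
        (simp_all add: ne targets V insert_commute m(3-8) na sym inn)
    then show ?thesis by (simp add: listed_def)
  next
    case cycle
    have "G \<cong>\<^sub>G cycle_graph 6"
      by (intro graph_iso_lists'[of "[x1, y2, x2, y3, x3, y1]" "[0, 1, 2, 3, 4, 5]"])
        (simp_all add: ne targets V insert_commute m(3-8) na sym cycle)
    then show ?thesis by (simp add: listed_def)
  next
    \<comment> \<open>The 4-cycle is \<open>x1\<close>, \<open>y3\<close>, \<open>x2\<close>,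
      \<open>y2\<close>; the pendants are \<open>y1\<close> at \<open>x1\<close> and
      \<open>x3\<close> at \<open>y3\<close>.\<close>
    case trans
    have "G \<cong>\<^sub>G graph_C"
      by (intro graph_iso_lists'[of "[x1, y3, x2, y2, y1, x3]" "[1, 2, 3, 4, 5, 6]"])
        (simp_all add: ne targets V insert_commute m(3-8) na sym trans)
    then show ?thesis by (simp add: listed_def)
  next
    \<comment> \<open>The two 4-cycles share the edge from \<open>x1\<close> to
      \<open>y1\<close>.\<close>
    case B1
    have "G \<cong>\<^sub>G graph_B"
      by (intro graph_iso_lists'[of "[y2, x1, y3, x2, y1, x3]" "[1, 2, 3, 4, 5, 6]"])
        (simp_all add: ne targets V insert_commute m(3-8) na sym B1)
    then show ?thesis by (simp add: listed_def)
  next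
    \<comment> \<open>The two 4-cycles share the edge from \<open>x1\<close> to
      \<open>y2\<close>.\<close>
    case B2
    have "G \<cong>\<^sub>G graph_B"
      by (intro graph_iso_lists'[of "[y1, x1, y3, x2, y2, x3]" "[1, 2, 3, 4, 5, 6]"])
        (simp_all add: ne targets V insert_commute m(3-8) na sym B2)
    then show ?thesis by (simp add: listed_def)
  qed
qed

text \<open>Together with \<open>bipartitioned_swap23\<close> this generates all relabellings of the
  three indices.\<close>

lemma bipartitioned_swap12:
  "bipartitioned x1 y1 x2 y2 x3 y3 \<Longrightarrow> bipartitioned x2 y2 x1 y1 x3 y3"
  unfolding bipartitioned_def matched_def by (simp add: adj_commute insert_commute)

lemma bipartitioned_swap23:
  "bipartitioned x1 y1 x2 y2 x3 y3 \<Longrightarrow> bipartitioned x1 y1 x3 y3 x2 y2"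
  unfolding bipartitioned_def matched_def by (simp add: adj_commute insert_commute)

text \<open>Exchanging the sides reverses the digraph, so a result on out-neighbours yields one on
  in-neighbours.\<close>

lemma bipartitioned_flip:
  "bipartitioned x1 y1 x2 y2 x3 y3 \<Longrightarrow> bipartitioned y1 x1 y2 x2 y3 x3"
  unfolding bipartitioned_def matched_def by (simp add: adj_commute insert_commute)

text \<open>\<open>x1\<close> and \<open>x2\<close> have \<open>y1\<close> and \<open>y2\<close> as
  common neighbours, so only \<open>y3\<close> can tell them apart.\<close>

lemma bipartitioned_no_twins:
  assumes bip: "bipartitioned x1 y1 x2 y2 x3 y3" and "adj x1 y2" "adj x2 y1"
  shows "adj x1 y3 \<noteq> adj x2 y3"
proof -
  note m = matchedD[OF bipartitioned_matched[OF bip]] and na = bipartitioned_nonadj[OF bip]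
  have "\<exists>w\<in>pverts G. adj x1 w \<noteq> adj x2 w"
    using m(1) by (intro twin_free) (simp_all add: m(2))
  then show ?thesis
    using assms(2,3) by (simp add: m(2-8) na)
qed

lemma bipartitioned_no_twins':
  assumes bip: "bipartitioned x1 y1 x2 y2 x3 y3" and "adj x1 y2" "adj x2 y1"
  shows "adj x3 y1 \<noteq> adj x3 y2"
  using bipartitioned_no_twins[OF bipartitioned_flip[OF bip]] assms(2,3)
    adj_commute[of y1 x2] adj_commute[of y2 x1] adj_commute[of y1 x3] adj_commute[of y2 x3]
  by simp

lemma bipartitioned_listed:
  assumes bip: "bipartitioned x1 y1 x2 y2 x3 y3"
  shows "listed G"
proof -
  \<comment> \<open>The digits give the order of the indices. \<open>perms\<close> lists all six
    orders as in the conclusion of \<open>digraph_three_normal\<close>.\<close>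
  note b213 = bipartitioned_swap12[OF bip] and b132 = bipartitioned_swap23[OF bip]
  note b231 = bipartitioned_swap23[OF b213] and b312 = bipartitioned_swap12[OF b132]
  note perms = bip b132 b213 b231 b312 bipartitioned_swap12[OF b231]
  have "adj x1 y3 \<noteq> adj x2 y3 \<and> adj x3 y1 \<noteq> adj x3 y2" if "adj x1 y2 \<and> adj x2 y1"
    using that bipartitioned_no_twins[OF bip] bipartitioned_no_twins'[OF bip] by blast
  moreover have "adj x1 y2 \<noteq> adj x3 y2 \<and> adj x2 y1 \<noteq> adj x2 y3" if "adj x1 y3 \<and> adj x3 y1"
    using that bipartitioned_no_twins[OF b132] bipartitioned_no_twins'[OF b132] by blast
  moreover have "adj x2 y1 \<noteq> adj x3 y1 \<and> adj x1 y2 \<noteq> adj x1 y3" if "adj x2 y3 \<and> adj x3 y2"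
    using that bipartitioned_no_twins[OF b231] bipartitioned_no_twins'[OF b231] by blast
  ultimately have "normal (adj x1 y2) (adj x2 y1) (adj x1 y3) (adj x3 y1) (adj x2 y3) (adj x3 y2) \<or>
    normal (adj x1 y3) (adj x3 y1) (adj x1 y2) (adj x2 y1) (adj x3 y2) (adj x2 y3) \<or>
    normal (adj x2 y1) (adj x1 y2) (adj x2 y3) (adj x3 y2) (adj x1 y3) (adj x3 y1) \<or>
    normal (adj x2 y3) (adj x3 y2) (adj x2 y1) (adj x1 y2) (adj x3 y1) (adj x1 y3) \<or>
    normal (adj x3 y1) (adj x1 y3) (adj x3 y2) (adj x2 y3) (adj x1 y2) (adj x2 y1) \<or>
    normal (adj x3 y2) (adj x2 y3) (adj x3 y1) (adj x1 y3) (adj x2 y1) (adj x1 y2)"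
    by (rule digraph_three_normal)
  then show ?thesis
    using perms[THEN bipartitioned_normal_listed] by argo
qed

section \<open>The non-bipartite case\<close>

text \<open>The name is that of signed graphs: matching edges are the vertices, a parallel pair is
  negative, a crossing pair positive, and interchanging the ends of a matching edge is switching.
  Three negative pairs form an unbalanced triangle.\<close>

definition unbalanced :: "'a \<Rightarrow> 'a \<Rightarrow> 'a \<Rightarrow> 'a \<Rightarrow> 'a \<Rightarrow> 'a \<Rightarrow> bool" where
  "unbalanced a1 b1 a2 b2 a3 b3 \<longleftrightarrow> matched a1 b1 a2 b2 a3 b3 \<and>
    \<not> adj a1 b2 \<and> \<not> adj a1 b3 \<and> \<not> adj a2 b1 \<and> \<not> adj a2 b3 \<and> \<not> adj a3 b1 \<and> \<not> adj a3 b2 \<and>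
    (adj a1 a2 \<or> adj b1 b2) \<and> (adj a1 a3 \<or> adj b1 b3) \<and> (adj a2 a3 \<or> adj b2 b3)"

lemma unbalanced_swap12: "unbalanced a1 b1 a2 b2 a3 b3 \<Longrightarrow> unbalanced a2 b2 a1 b1 a3 b3"
  unfolding unbalanced_def matched_def by (simp add: adj_commute insert_commute)

lemma unbalanced_swap23: "unbalanced a1 b1 a2 b2 a3 b3 \<Longrightarrow> unbalanced a1 b1 a3 b3 a2 b2"
  unfolding unbalanced_def matched_def by (simp add: adj_commute insert_commute)

lemma unbalanced_flip: "unbalanced a1 b1 a2 b2 a3 b3 \<Longrightarrow> unbalanced b1 a1 b2 a2 b3 a3"
  unfolding unbalanced_def matched_def by (simp add: adj_commute insert_commute disj_commute)

text \<open>\<open>a1\<close> and \<open>a3\<close> are not adjacent, so \<open>b1\<close> and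
  \<open>b3\<close> are, and \<open>a1\<close>, \<open>a2\<close>, \<open>a3\<close>,
  \<open>b3\<close>, \<open>b1\<close> form a 5-cycle. It remains to see that \<open>b2\<close> is
  pendant at \<open>a2\<close>.\<close>

lemma unbalanced_path_listed:
  assumes unb: "unbalanced a1 b1 a2 b2 a3 b3" and "adj a1 a2" "adj a2 a3"
  shows "listed G"
proof -
  have mt: "matched a1 b1 a2 b2 a3 b3" using unb by (simp add: unbalanced_def)
  note m = matchedD[OF mt]
  have unb': "\<not> adj a1 b2" "\<not> adj a1 b3" "\<not> adj a2 b1" "\<not> adj a2 b3" "\<not> adj a3 b1" "\<not> adj a3 b2"
    "adj a1 a3 \<or> adj b1 b3"
    using unb by (simp_all add: unbalanced_def)
  have na: "\<not> adj a1 b2" "\<not> adj a1 b3" "\<not> adj a2 b1" "\<not> adj a2 b3" "\<not> adj a3 b1" "\<not> adj a3 b2"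
    "\<not> adj b2 a1" "\<not> adj b3 a1" "\<not> adj b1 a2" "\<not> adj b3 a2" "\<not> adj b1 a3" "\<not> adj b2 a3"
    using unb' arcs_symmetric by blast+
  have a: "adj a1 a2" "adj a2 a3" "adj a2 a1" "adj a3 a2" "\<not> adj a1 a3" "\<not> adj a3 a1"
    using assms(2,3) no_triangle adj_commute by blast+
  have b13: "adj b1 b3" "adj b3 b1"
    using unb'(7) a arcs_symmetric by blast+
  \<comment> \<open>With this edge, \<open>a1\<close> and \<open>b2\<close> would both have exactly
    the neighbours \<open>b1\<close> and \<open>a2\<close>.\<close>
  have b12: "\<not> adj b1 b2"
  proof
    assume b12: "adj b1 b2"
    then have "adj b2 b1" "\<not> adj b2 b3"
      using b13 no_triangle adj_commute by blast+
    moreover have "\<exists>w\<in>pverts G. adj a1 w \<noteq> adj b2 w"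
      using m(1) by (intro twin_free) (simp_all add: m(2))
    ultimately show False
      using b12 by (simp add: m(2-8) na a)
  qed
  \<comment> \<open>With this edge, \<open>a3\<close> and \<open>b2\<close> would both have exactly
    the neighbours \<open>b3\<close> and \<open>a2\<close>.\<close>
  have b23: "\<not> adj b2 b3"
  proof
    assume b23: "adj b2 b3"
    have "\<not> adj b2 b1"
      using b12 adj_commute by blast
    moreover have "\<exists>w\<in>pverts G. adj a3 w \<noteq> adj b2 w"
      using m(1) by (intro twin_free) (auto simp add: m(2))
    ultimately show False
      using b23 by (simp add: m(2-8) na a)
  qed
  have b: "\<not> adj b1 b2" "\<not> adj b2 b3" "\<not> adj b2 b1" "\<not> adj b3 b2"
    using b12 b23 adj_commute by blast+
  note ne = m(1)[simplified] distinct_rev[THEN iffD2, OF m(1), simplified]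
  \<comment> \<open>The list runs around the 5-cycle from \<open>a2\<close>, because
    \<open>graph_F\<close> has its pendant at vertex 0.\<close>
  have "G \<cong>\<^sub>G graph_F"
    by (intro graph_iso_lists'[of "[a2, a3, b3, b1, a1, b2]" "[0, 1, 2, 3, 4, 5]"])
      (simp_all add: ne targets m(2-8) insert_commute na a b13 b)
  then show ?thesis by (simp add: listed_def)
qed

text \<open>Each of the three pairs has an edge on the \<open>a\<close> side or on the
  \<open>b\<close> side, so one side carries two of these edges. They share a vertex; swaps and the
  flip move the resulting path to \<open>a1\<close>, \<open>a2\<close>, \<open>a3\<close>.\<close>

lemma unbalanced_listed:
  assumes unb: "unbalanced a1 b1 a2 b2 a3 b3"
  shows "listed G"
proof -
  have "(adj a1 a2 \<or> adj b1 b2) \<and> (adj a1 a3 \<or> adj b1 b3) \<and> (adj a2 a3 \<or> adj b2 b3)"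
    using unb by (simp add: unbalanced_def)
  then consider "adj a1 a2" "adj a2 a3" | "adj a2 a1" "adj a1 a3" | "adj a1 a3" "adj a3 a2"
    | "adj b1 b2" "adj b2 b3" | "adj b2 b1" "adj b1 b3" | "adj b1 b3" "adj b3 b2"
    using arcs_symmetric by blast
  then show ?thesis
    using unbalanced_path_listed[OF unb] unbalanced_path_listed[OF unbalanced_swap12[OF unb]]
      unbalanced_path_listed[OF unbalanced_swap23[OF unb]]
      unbalanced_path_listed[OF unbalanced_flip[OF unb]]
      unbalanced_path_listed[OF unbalanced_flip[OF unbalanced_swap12[OF unb]]]
      unbalanced_path_listed[OF unbalanced_flip[OF unbalanced_swap23[OF unb]]]
    by cases simp_all
qed

section \<open>Choice of the ends of the matching edges\<close>

lemma matched_switch: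
  assumes "matched a1 b1 a2 b2 a3 b3"
  shows "matched b1 a1 a2 b2 a3 b3" "matched a1 b1 b2 a2 a3 b3" "matched a1 b1 a2 b2 b3 a3"
  using assms unfolding matched_def by (simp_all add: adj_commute insert_commute)

text \<open>A parallel and a crossing edge share an end, and their other ends are joined by a
  matching edge: a triangle.\<close>

lemma parallel_or_crossing:
  assumes "adj a b" "adj a' b'"
  shows "\<not> ((adj a a' \<or> adj b b') \<and> (adj a b' \<or> adj b a'))"
  using assms no_triangle adj_commute by blast

text \<open>If \<open>p\<close> is false, the \<open>a\<close> side and the \<open>b\<close> side
  form a bipartition. If it is true, every pair has a parallel edge, hence no crossing one.\<close>

lemma matched_coherent_listed:
  assumes mt: "matched a1 b1 a2 b2 a3 b3"
    and "adj a1 a2 \<or> adj b1 b2 \<longleftrightarrow> p" "adj a1 a3 \<or> adj b1 b3 \<longleftrightarrow> p" "adj a2 a3 \<or> adj b2 b3 \<longleftrightarrow> p"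
  shows "listed G"
proof (cases p)
  case True
  note m = matchedD[OF mt]
  have "unbalanced a1 b1 a2 b2 a3 b3"
    using assms True parallel_or_crossing[OF m(3,4)] parallel_or_crossing[OF m(3,5)]
      parallel_or_crossing[OF m(4,5)]
    by (simp add: unbalanced_def adj_commute[of b1 a2] adj_commute[of b1 a3]
      adj_commute[of b2 a3])
  then show ?thesis by (rule unbalanced_listed)
next
  case False
  then have "bipartitioned a1 b1 a2 b2 a3 b3"
    using assms by (simp add: bipartitioned_def)
  then show ?thesis by (rule bipartitioned_listed)
qed

lemma matched_listed:
  assumes mt: "matched a1 b1 a2 b2 a3 b3"
  shows "listed G"
proof -
  note m = matchedD[OF mt] and sw = matched_switch[OF mt]
  define s12 where "s12 \<longleftrightarrow> adj a1 a2 \<or> adj b1 b2"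
  define s13 where "s13 \<longleftrightarrow> adj a1 a3 \<or> adj b1 b3"
  define s23 where "s23 \<longleftrightarrow> adj a2 a3 \<or> adj b2 b3"
  define c12 where "c12 \<longleftrightarrow> adj a1 b2 \<or> adj b1 a2"
  define c13 where "c13 \<longleftrightarrow> adj a1 b3 \<or> adj b1 a3"
  define c23 where "c23 \<longleftrightarrow> adj a2 b3 \<or> adj b2 a3"
  note defs = s12_def s13_def s23_def c12_def c13_def c23_def
  have "\<not> (s12 \<and> c12)" "\<not> (s13 \<and> c13)" "\<not> (s23 \<and> c23)"
    using parallel_or_crossing[OF m(3,4)] parallel_or_crossing[OF m(3,5)]
      parallel_or_crossing[OF m(4,5)] by (simp_all add: defs)
  \<comment> \<open>The disjuncts stand for no switch and for a switch at index 1, 2 or 3. These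
    suffice, since switching all three changes nothing. A true \<open>p\<close> occurs when all
    three pairs are joined and an odd number of them is parallel.\<close>
  then have "\<exists>p. s12 = p \<and> s13 = p \<and> s23 = p \<or> c12 = p \<and> c13 = p \<and> s23 = p \<or>
      c12 = p \<and> s13 = p \<and> c23 = p \<or> s12 = p \<and> c13 = p \<and> c23 = p"
    by (cases s12; cases s13; cases s23; cases c12; cases c13; cases c23) (simp_all add: ex_bool_eq)
  then obtain p where "s12 = p \<and> s13 = p \<and> s23 = p \<or> c12 = p \<and> c13 = p \<and> s23 = p \<or>
      c12 = p \<and> s13 = p \<and> c23 = p \<or> s12 = p \<and> c13 = p \<and> c23 = p" ..
  then show ?thesis
  proof (elim disjE)
    assume "s12 = p \<and> s13 = p \<and> s23 = p"
    then show ?thesis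
      by (intro matched_coherent_listed[OF mt, of p]) (auto simp: defs)
  next
    assume "c12 = p \<and> c13 = p \<and> s23 = p"
    then show ?thesis
      by (intro matched_coherent_listed[OF sw(1), of p]) (auto simp: defs)
  next
    assume "c12 = p \<and> s13 = p \<and> c23 = p"
    then show ?thesis
      by (intro matched_coherent_listed[OF sw(2), of p]) (auto simp: defs)
  next
    assume "s12 = p \<and> c13 = p \<and> c23 = p"
    then show ?thesis
      by (intro matched_coherent_listed[OF sw(3), of p]) (auto simp: defs)
  qed
qed

end

section \<open>Reduction of nonsingular graphs to matched twin-free ones\<close>

theorem theorem3p1:
  fixes G :: "'a pair_pre_digraph"
  assumes "pair_graph G"
    and "card (pverts G) = 6"
    and "triangle_free G"
    and "nonsingular_graph G"
  shows "G \<cong>\<^sub>G cycle_graph 6 \<or>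
         G \<cong>\<^sub>G graph_B \<or>
         G \<cong>\<^sub>G graph_C \<or>
         G \<cong>\<^sub>G path_graph 6 \<or>
         G \<cong>\<^sub>G graph_E \<or>
         G \<cong>\<^sub>G graph_F \<or>
         G \<cong>\<^sub>G copies 3 (path_graph 2) \<or>
         G \<cong>\<^sub>G disjoint_union (path_graph 2) (path_graph 4)"
proof -
  interpret pair_graph G by fact
  interpret twin_free_six_graph G
    using assms nonsingular_graph_twin_free[OF assms(4)] by unfold_locales
  obtain f where f: "bij_betw f (pverts G) (pverts G)" "\<And>v. v \<in> pverts G \<Longrightarrow> adj v (f v)"
    using nonsingular_graph_permutation[OF assms(4)] by blast
  have "\<exists>a b c d e g. distinct [a, b, c, d, e, g] \<and> set [a, b, c, d, e, g] = pverts G \<and>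
    adj a b \<and> adj c d \<and> adj e g"
    using f(2) no_triangle adj_commute by (intro six_permutation_matching[OF assms(2) f(1)]) auto
  then obtain a b c d e g where "matched a b c d e g"
    unfolding matched_def list.set by metis
  then have "listed G" by (rule matched_listed)
  then show ?thesis
    unfolding listed_def .
qed

end
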